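(* Let $\mathcal D\subset\mathcal S\subset\mathbb R^d$, $d\le3$, be polyhedral domains with triangulations $\mathcal T_h$ (of $\mathcal D$) and $\mathcal T_{h'}$ (of $\mathcal S$). Let $q$ be a bounded and continuous positive semidefinite kernel on $\mathcal S$. For $b\in L^2(\mathcal D)$ let $B\in\mathcal L(L^\infty(\mathcal D),L^2(\mathcal D))$ be given by $(Bv)(x):=b(x)v(x)$ for a.e. $x\in\mathcal D$. Then $$\|B\,I_hR_{\mathcal S\to\mathcal D}I_{h'}\|_{\mathcal L_2(H_q(\mathcal S),L^2(\mathcal D))}\le2\sup_{x,y\in\mathcal S}\sqrt{|q(x,y)|}\;\|b\|_{L^2(\mathcal D)}\quad\text{for all }b\in L^2(\mathcal D).$$
   Context: Polyhedral domains are bounded, and triangulations are partitions into finitely many simplices (conforming, as usual in the finite element method). $I_h$ and $I_{h'}$ are the piecewise linear nodal interpolants with respect to $\mathcal T_h$ and $\mathcal T_{h'}$: for a function $v$ on $\mathcal D$, $I_hv$ is the unique continuous function that is affine on each simplex of $\mathcal T_h$ and agrees with $v$ at all nodes (vertices) of $\mathcal T_h$; similarly for $I_{h'}$ on $\mathcal S$. (Continuous piecewise linear functions are regarded as defined on the closed domain, and $q$ and functions in its RKHS are evaluated at all nodes.) $R_{\mathcal S\to\mathcal D}$ restricts functions on $\mathcal S$ to $\mathcal D$. $H_q(\mathcal S)$ is the reproducing kernel Hilbert space of $q$ on $\mathcal S$, and $\mathcal L_2(U,E)$ denotes the Hilbert–Schmidt operators from $U$ to $E$. *)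

theory Defs
  imports "HOL-Analysis.Analysis"
begin

section \<open>Polyhedral domains, triangulations and nodal interpolation\<close>

text \<open>The library's \<^const>\<open>polyhedron\<close> and \<^const>\<open>polytope\<close> are convex sets. A polyhedral domain need not be
  convex: it is a bounded, nonempty, open and connected set whose boundary consists of finitely many
  polytopes of codimension one.\<close>

definition polyhedral_domain :: "'a::euclidean_space set \<Rightarrow> bool" where
  "polyhedral_domain D \<longleftrightarrow>
     open D \<and> connected D \<and> D \<noteq> {} \<and> bounded D \<and>
     (\<exists>\<F>. finite \<F> \<and> (\<forall>F\<in>\<F>. polytope F \<and> aff_dim F = int DIM('a) - 1) \<and> frontier D = \<Union>\<F>)"

text \<open>\<^const>\<open>triangulation\<close> contains finiteness and conformity (two simplices meet in a common, possibly
  empty, face). The simplices are closed, so they cover the closed domain.\<close>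

definition triangulation_of :: "'a::euclidean_space set set \<Rightarrow> 'a set \<Rightarrow> bool" where
  "triangulation_of \<T> D \<longleftrightarrow>
     triangulation \<T> \<and> (\<forall>K\<in>\<T>. int DIM('a) simplex K) \<and> \<Union>\<T> = closure D"

definition nodes :: "'a::euclidean_space set set \<Rightarrow> 'a set" where
  "nodes \<T> = {z. \<exists>K\<in>\<T>. z extreme_point_of K}"

definition affine_fun_on :: "'a::euclidean_space set \<Rightarrow> ('a \<Rightarrow> real) \<Rightarrow> bool" where
  "affine_fun_on K w \<longleftrightarrow> (\<exists>a c. \<forall>x\<in>K. w x = a \<bullet> x + c)"

text \<open>Throughout, a function on a set \<open>X\<close> is represented by its extension by zero outside \<open>X\<close>.
  This is the last clause below; without it the interpolant would not be unique as a total function.\<close>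

definition nodal_interpolant ::
    "'a::euclidean_space set set \<Rightarrow> ('a \<Rightarrow> real) \<Rightarrow> 'a \<Rightarrow> real" where
  "nodal_interpolant \<T> v =
     (THE w. continuous_on (\<Union>\<T>) w \<and> (\<forall>K\<in>\<T>. affine_fun_on K w) \<and>
             (\<forall>z\<in>nodes \<T>. w z = v z) \<and> (\<forall>x. x \<notin> \<Union>\<T> \<longrightarrow> w x = 0))"

definition restriction :: "'a set \<Rightarrow> ('a \<Rightarrow> real) \<Rightarrow> 'a \<Rightarrow> real" where
  "restriction X v = (\<lambda>x. if x \<in> X then v x else 0)"

definition mult_op :: "('a \<Rightarrow> real) \<Rightarrow> ('a \<Rightarrow> real) \<Rightarrow> 'a \<Rightarrow> real" where
  "mult_op b v = (\<lambda>x. b x * v x)"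


section \<open>Reproducing kernel Hilbert spaces\<close>

definition psd_kernel_on :: "'a set \<Rightarrow> ('a \<Rightarrow> 'a \<Rightarrow> real) \<Rightarrow> bool" where
  "psd_kernel_on X q \<longleftrightarrow>
     (\<forall>x\<in>X. \<forall>y\<in>X. q x y = q y x) \<and>
     (\<forall>F c. finite F \<and> F \<subseteq> X \<longrightarrow> 0 \<le> (\<Sum>x\<in>F. \<Sum>y\<in>F. c x * c y * q x y))"

text \<open>A real Hilbert space \<open>(H, ip)\<close> whose elements are functions on \<open>X\<close>. The inner product is
  only constrained on \<open>H\<close>.\<close>

locale function_hilbert_space =
  fixes X :: "'a set" and H :: "('a \<Rightarrow> real) set" and ip :: "('a \<Rightarrow> real) \<Rightarrow> ('a \<Rightarrow> real) \<Rightarrow> real"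
  assumes outside: "\<And>f x. f \<in> H \<Longrightarrow> x \<notin> X \<Longrightarrow> f x = 0"
    and zero_mem: "(\<lambda>x. 0) \<in> H"
    and add_mem: "\<And>f g. f \<in> H \<Longrightarrow> g \<in> H \<Longrightarrow> (\<lambda>x. f x + g x) \<in> H"
    and scale_mem: "\<And>c f. f \<in> H \<Longrightarrow> (\<lambda>x. c * f x) \<in> H"
    and ip_commute: "\<And>f g. f \<in> H \<Longrightarrow> g \<in> H \<Longrightarrow> ip f g = ip g f"
    and ip_add: "\<And>f g h. f \<in> H \<Longrightarrow> g \<in> H \<Longrightarrow> h \<in> H \<Longrightarrow> ip (\<lambda>x. f x + g x) h = ip f h + ip g h"
    and ip_scale: "\<And>c f g. f \<in> H \<Longrightarrow> g \<in> H \<Longrightarrow> ip (\<lambda>x. c * f x) g = c * ip f g"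
    and ip_nonneg: "\<And>f. f \<in> H \<Longrightarrow> 0 \<le> ip f f"
    and ip_definite: "\<And>f. f \<in> H \<Longrightarrow> ip f f = 0 \<Longrightarrow> f = (\<lambda>x. 0)"
    and complete: "\<And>s :: nat \<Rightarrow> 'a \<Rightarrow> real. range s \<subseteq> H \<Longrightarrow>
      (\<forall>\<epsilon>>0. \<exists>N. \<forall>m\<ge>N. \<forall>n\<ge>N. sqrt (ip (\<lambda>x. s m x - s n x) (\<lambda>x. s m x - s n x)) < \<epsilon>) \<Longrightarrow>
      \<exists>f\<in>H. (\<lambda>n. sqrt (ip (\<lambda>x. s n x - f x) (\<lambda>x. s n x - f x))) \<longlonglongrightarrow> 0"

text \<open>By the Moore-Aronszajn theorem, every positive semidefinite kernel \<open>q\<close> on \<open>X\<close> has exactly one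
  such pair (\<open>ip\<close> being unique on \<open>H\<close>).\<close>

locale rkhs = function_hilbert_space X H ip
  for X :: "'a set" and q :: "'a \<Rightarrow> 'a \<Rightarrow> real" and H :: "('a \<Rightarrow> real) set"
    and ip :: "('a \<Rightarrow> real) \<Rightarrow> ('a \<Rightarrow> real) \<Rightarrow> real" +
  assumes kernel_mem: "\<And>x. x \<in> X \<Longrightarrow> restriction X (\<lambda>y. q y x) \<in> H"
    and reproducing: "\<And>f x. f \<in> H \<Longrightarrow> x \<in> X \<Longrightarrow> f x = ip f (restriction X (\<lambda>y. q y x))"


section \<open>The space $L^2$ and Hilbert-Schmidt operators\<close>

text \<open>Elements of $L^2$ are given by representatives, identified up to equality almost everywhere.\<close>

definition L2_space :: "'a measure \<Rightarrow> ('a \<Rightarrow> real) set" where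
  "L2_space M = {f \<in> borel_measurable M. integrable M (\<lambda>x. (f x)\<^sup>2)}"

definition L2_norm :: "'a measure \<Rightarrow> ('a \<Rightarrow> real) \<Rightarrow> real" where
  "L2_norm M f = sqrt (LINT x|M. (f x)\<^sup>2)"

definition orthonormal_basis ::
    "('a \<Rightarrow> real) set \<Rightarrow> (('a \<Rightarrow> real) \<Rightarrow> ('a \<Rightarrow> real) \<Rightarrow> real) \<Rightarrow> ('a \<Rightarrow> real) set \<Rightarrow> bool" where
  "orthonormal_basis H ip E \<longleftrightarrow>
     E \<subseteq> H \<and>
     (\<forall>e\<in>E. \<forall>e'\<in>E. ip e e' = (if e = e' then 1 else 0)) \<and>
     (\<forall>f\<in>H. (\<forall>e\<in>E. ip f e = 0) \<longrightarrow> f = (\<lambda>x. 0))"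

definition bounded_linear_to_L2 ::
    "('a \<Rightarrow> real) set \<Rightarrow> (('a \<Rightarrow> real) \<Rightarrow> ('a \<Rightarrow> real) \<Rightarrow> real) \<Rightarrow> 'b measure \<Rightarrow>
     (('a \<Rightarrow> real) \<Rightarrow> 'b \<Rightarrow> real) \<Rightarrow> bool" where
  "bounded_linear_to_L2 H ip M T \<longleftrightarrow>
     (\<forall>f\<in>H. T f \<in> L2_space M) \<and>
     (\<forall>f\<in>H. \<forall>g\<in>H. AE x in M. T (\<lambda>y. f y + g y) x = T f x + T g x) \<and>
     (\<forall>c. \<forall>f\<in>H. AE x in M. T (\<lambda>y. c * f y) x = c * T f x) \<and>
     (\<exists>C. \<forall>f\<in>H. L2_norm M (T f) \<le> C * sqrt (ip f f))"

definition hilbert_schmidt ::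
    "('a \<Rightarrow> real) set \<Rightarrow> (('a \<Rightarrow> real) \<Rightarrow> ('a \<Rightarrow> real) \<Rightarrow> real) \<Rightarrow> 'b measure \<Rightarrow>
     (('a \<Rightarrow> real) \<Rightarrow> 'b \<Rightarrow> real) \<Rightarrow> bool" where
  "hilbert_schmidt H ip M T \<longleftrightarrow>
     bounded_linear_to_L2 H ip M T \<and>
     (\<forall>E. orthonormal_basis H ip E \<longrightarrow> (\<lambda>e. (L2_norm M (T e))\<^sup>2) summable_on E)"

text \<open>The choice of the orthonormal basis is immaterial. The value is meaningful only for
  Hilbert-Schmidt operators, as \<^const>\<open>infsum\<close> is 0 for a family that is not summable.\<close>

definition hs_norm ::
    "('a \<Rightarrow> real) set \<Rightarrow> (('a \<Rightarrow> real) \<Rightarrow> ('a \<Rightarrow> real) \<Rightarrow> real) \<Rightarrow> 'b measure \<Rightarrow>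
     (('a \<Rightarrow> real) \<Rightarrow> 'b \<Rightarrow> real) \<Rightarrow> real" where
  "hs_norm H ip M T =
     sqrt (\<Sum>\<^sub>\<infinity>e\<in>(SOME E. orthonormal_basis H ip E). (L2_norm M (T e))\<^sup>2)"

end

theory Submission
  imports Defs
begin

text \<open>A nodal interpolant evaluates at a point as a convex combination of nodal values whose weights
  do not depend on the interpolated function, and this property survives the composition of the two
  interpolants. Thus the operator is \<open>f \<mapsto> (x \<mapsto> b x * ip f (k x))\<close>, where \<open>k x\<close> is a convex
  combination of kernel sections, so that \<open>ip (k x) (k x) \<le> sup \<bar>q\<bar>\<close>. Bessel's inequality
  bounds the sum of \<open>(T e x)\<^sup>2\<close> over an orthonormal family by \<open>(b x)\<^sup>2 * sup \<bar>q\<bar>\<close>; integration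
  over \<open>x\<close> gives the estimate, even without the factor 2.\<close>

section \<open>Nodal interpolation\<close>

lemma affine_fun_on_convex_combination:
  assumes "affine_fun_on K w" "C \<subseteq> K" "x \<in> K" "x = (\<Sum>z\<in>C. u z *\<^sub>R z)" "sum u C = 1"
  shows "w x = (\<Sum>z\<in>C. u z * w z)"
proof -
  obtain a c where w: "\<And>y. y \<in> K \<Longrightarrow> w y = a \<bullet> y + c"
    using assms(1) by (auto simp: affine_fun_on_def)
  have "(\<Sum>z\<in>C. u z * w z) = (\<Sum>z\<in>C. u z * (a \<bullet> z) + u z * c)"
    using assms(2) by (intro sum.cong) (auto simp: w algebra_simps)
  also have "\<dots> = a \<bullet> x + c"
    using assms(5) by (simp add: assms(4) inner_sum_right sum.distrib flip: sum_distrib_right)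
  finally show ?thesis using w[OF assms(3)] by simp
qed

text \<open>Subtracting a base point \<open>p\<close> turns affine independence into linear
  independence of the differences, on which a linear functional may take any prescribed values. The
  constant \<open>c\<close> then corrects the value at \<open>p\<close>.\<close>

lemma affine_interpolation:
  fixes C :: "'a::euclidean_space set" and v :: "'a \<Rightarrow> real"
  assumes "\<not> affine_dependent C"
  obtains a c where "\<And>z. z \<in> C \<Longrightarrow> a \<bullet> z + c = v z"
proof (cases "C = {}")
  case True
  then show ?thesis using that[of 0 0] by simp
next
  case False
  then obtain p where p: "p \<in> C" by blast
  have "independent ((\<lambda>x. -p + x) ` (C - {p}))"
    using affine_dependent_iff_dependent2[OF p] assms by simp
  then obtain g where g: "linear g"
      "\<And>y. y \<in> (\<lambda>x. -p + x) ` (C - {p}) \<Longrightarrow> g y = v (p + y) - v p"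
    using linear_independent_extend[of _ "\<lambda>y. v (p + y) - v p"] by blast
  \<comment> \<open>\<open>adjoint g 1\<close> is the vector that represents the functional
    \<open>g\<close>, that is, the gradient \<open>a\<close>.\<close>
  have ga: "g y = adjoint g 1 \<bullet> y" for y
    using adjoint_works[OF g(1), of y 1] by (simp add: inner_commute)
  have "adjoint g 1 \<bullet> z + (v p - adjoint g 1 \<bullet> p) = v z" if "z \<in> C" for z
  proof (cases "z = p")
    case False
    with g(2)[of "-p + z"] that have "g (-p + z) = v z - v p" by auto
    then show ?thesis by (simp add: ga inner_diff_right)
  qed simp
  then show ?thesis using that by blast
qed

text \<open>\<open>simplex\<close> only asserts that some vertex set exists, whereas
  \<open>nodes\<close> speaks of extreme points. Affine independence makes the two sets
  coincide.\<close>

lemma simplex_eq_convex_hull_extreme_points: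
  assumes "n simplex K"
  shows "K = convex hull {z. z extreme_point_of K}"
    and "finite {z. z extreme_point_of K}"
    and "\<not> affine_dependent {z. z extreme_point_of K}"
proof -
  obtain C where C: "\<not> affine_dependent C" "K = convex hull C"
    using assms by (auto simp: simplex_def)
  then have "{z. z extreme_point_of K} = C"
    by (simp add: extreme_point_of_convex_hull_affine_independent)
  with C show "K = convex hull {z. z extreme_point_of K}"
    and "finite {z. z extreme_point_of K}"
    and "\<not> affine_dependent {z. z extreme_point_of K}"
    by (auto intro: aff_independent_finite)
qed

lemma convex_combination_extreme_points:
  assumes "n simplex K" "x \<in> K"
  obtains u where "\<And>z. z extreme_point_of K \<Longrightarrow> 0 \<le> u z"
    "sum u {z. z extreme_point_of K} = 1" "x = (\<Sum>z | z extreme_point_of K. u z *\<^sub>R z)"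
proof -
  have "x \<in> convex hull {z. z extreme_point_of K}"
    using simplex_eq_convex_hull_extreme_points(1)[OF assms(1)] assms(2) by blast
  then show ?thesis
    using that by (auto simp: convex_hull_finite[OF simplex_eq_convex_hull_extreme_points(2)[OF assms(1)]])
qed

section \<open>Nodes of a triangulation and the nodal interpolant\<close>

lemma extreme_points_subset: "{z. z extreme_point_of K} \<subseteq> K"
  by (auto simp: extreme_point_of_def)

lemma finite_nodes:
  assumes "triangulation \<T>"
  shows "finite (nodes \<T>)"
proof -
  have "nodes \<T> = (\<Union>K\<in>\<T>. {z. z extreme_point_of K})"
    by (auto simp: nodes_def)
  then show ?thesis
    using assms simplex_eq_convex_hull_extreme_points(2) by (fastforce simp: triangulation_def)
qed

lemma nodes_subset: "nodes \<T> \<subseteq> \<Union>\<T>"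
  using extreme_points_subset by (fastforce simp: nodes_def)

text \<open>The condition under \<open>THE\<close> in \<open>nodal_interpolant\<close>, named so
  that existence and uniqueness can be treated before the description is resolved.\<close>

definition is_nodal_interpolant ::
    "'a::euclidean_space set set \<Rightarrow> ('a \<Rightarrow> real) \<Rightarrow> ('a \<Rightarrow> real) \<Rightarrow> bool" where
  "is_nodal_interpolant \<T> v w \<longleftrightarrow> continuous_on (\<Union>\<T>) w \<and> (\<forall>K\<in>\<T>. affine_fun_on K w) \<and>
     (\<forall>z\<in>nodes \<T>. w z = v z) \<and> (\<forall>x. x \<notin> \<Union>\<T> \<longrightarrow> w x = 0)"

text \<open>The weights are the barycentric coordinates of \<open>x\<close> in a simplex containing
  it, set to zero at all other nodes. They are fixed before \<open>v\<close> and \<open>w\<close>,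
  so the formula also yields uniqueness of the interpolant.\<close>

lemma interpolant_convex_combination:
  assumes "triangulation \<T>" "x \<in> \<Union>\<T>"
  obtains u where "\<And>z. z \<in> nodes \<T> \<Longrightarrow> 0 \<le> u z" "sum u (nodes \<T>) = 1"
    "\<And>v w. is_nodal_interpolant \<T> v w \<Longrightarrow> w x = (\<Sum>z\<in>nodes \<T>. u z * v z)"
proof -
  obtain K where K: "K \<in> \<T>" "x \<in> K" using assms(2) by blast
  then obtain n where n: "n simplex K" using assms(1) by (auto simp: triangulation_def)
  let ?C = "{z. z extreme_point_of K}"
  obtain u where u: "\<And>z. z \<in> ?C \<Longrightarrow> 0 \<le> u z" "sum u ?C = 1" "x = (\<Sum>z\<in>?C. u z *\<^sub>R z)"
    using convex_combination_extreme_points[OF n K(2)] by (metis mem_Collect_eq)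
  have C: "?C \<subseteq> nodes \<T>" using K by (auto simp: nodes_def)
  have fin: "finite (nodes \<T>)" by (rule finite_nodes[OF assms(1)])
  define u' where "u' z = (if z \<in> ?C then u z else 0)" for z
  have ext: "(\<Sum>z\<in>nodes \<T>. u' z * f z) = (\<Sum>z\<in>?C. u z * f z)" for f
    using C fin by (intro sum.mono_neutral_cong_right) (auto simp: u'_def)
  show ?thesis
  proof
    show "0 \<le> u' z" for z using u(1) by (auto simp: u'_def)
    show "sum u' (nodes \<T>) = 1" using ext[of "\<lambda>_. 1"] u(2) by simp
    fix v w assume w: "is_nodal_interpolant \<T> v w"
    then have "w x = (\<Sum>z\<in>?C. u z * w z)"
      using K u by (intro affine_fun_on_convex_combination[of K])
        (auto simp: is_nodal_interpolant_def intro: extreme_points_subset[THEN subsetD])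
    also have "\<dots> = (\<Sum>z\<in>?C. u z * v z)"
      using w C by (intro sum.cong) (auto simp: is_nodal_interpolant_def)
    finally show "w x = (\<Sum>z\<in>nodes \<T>. u' z * v z)" by (simp only: ext)
  qed
qed

text \<open>The affine interpolants of the single simplices are glued. Conformity makes them agree
  on overlaps, and continuity follows because the simplices form a finite closed cover.\<close>

lemma nodal_interpolant_exists:
  assumes \<T>: "triangulation \<T>"
  shows "\<exists>w. is_nodal_interpolant \<T> v w"
proof -
  have simplices: "\<exists>n. n simplex K" if "K \<in> \<T>" for K using \<T> that by (auto simp: triangulation_def)
  have "\<forall>K\<in>\<T>. \<exists>g. (\<forall>z. z extreme_point_of K \<longrightarrow> g z = v z) \<and> (\<exists>a c. \<forall>x. g x = a \<bullet> x + c)"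
  proof
    fix K assume "K \<in> \<T>"
    then obtain n where n: "n simplex K" using simplices by blast
    obtain a c where "\<And>z. z \<in> {z. z extreme_point_of K} \<Longrightarrow> a \<bullet> z + c = v z"
      using affine_interpolation[OF simplex_eq_convex_hull_extreme_points(3)[OF n]] by blast
    then show "\<exists>g. (\<forall>z. z extreme_point_of K \<longrightarrow> g z = v z) \<and> (\<exists>a c. \<forall>x. g x = a \<bullet> x + c)"
      by (intro exI[of _ "\<lambda>x. a \<bullet> x + c"]) auto
  qed
  then obtain G where G: "\<And>K z. K \<in> \<T> \<Longrightarrow> z extreme_point_of K \<Longrightarrow> G K z = v z"
    and aff: "\<And>K. K \<in> \<T> \<Longrightarrow> \<exists>a c. \<forall>x. G K x = a \<bullet> x + c"
    by metis
  \<comment> \<open>By conformity \<open>K \<inter> L\<close> is a common face, so its extreme points are nodes of both simplices.\<close>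
  have agree: "G K x = G L x" if KL: "K \<in> \<T>" "L \<in> \<T>" "x \<in> K" "x \<in> L" for K L x
  proof -
    have "(K \<inter> L) face_of K" "(L \<inter> K) face_of L"
      using \<T> KL by (simp_all add: triangulation_def)
    then have face: "(K \<inter> L) face_of K" "(K \<inter> L) face_of L" by (simp_all add: Int_commute)
    obtain n where n: "n simplex K" using simplices KL by blast
    have "polytope (K \<inter> L)"
      using face_of_polytope_polytope[OF _ face(1)] simplex_imp_polytope[OF n] by blast
    then have "x \<in> convex hull {z. z extreme_point_of (K \<inter> L)}"
      using Krein_Milman_Minkowski[of "K \<inter> L"] KL
      by (auto simp: polytope_imp_compact polytope_imp_convex)
    moreover have "finite {z. z extreme_point_of (K \<inter> L)}"
      using simplex_eq_convex_hull_extreme_points(2)[OF n]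
      by (rule rev_finite_subset) (use extreme_point_of_face[OF face(1)] in auto)
    ultimately obtain u where u: "sum u {z. z extreme_point_of (K \<inter> L)} = 1"
        "(\<Sum>z | z extreme_point_of (K \<inter> L). u z *\<^sub>R z) = x"
      by (auto simp: convex_hull_finite)
    \<comment> \<open>The right-hand side does not depend on \<open>M\<close>, so the instances
      \<open>K\<close> and \<open>L\<close> give the agreement at \<open>x\<close>.\<close>
    have "G M x = (\<Sum>z | z extreme_point_of (K \<inter> L). u z * v z)"
      if M: "M \<in> \<T>" "(K \<inter> L) face_of M" for M
    proof -
      have "affine_fun_on UNIV (G M)" using aff[OF M(1)] by (auto simp: affine_fun_on_def)
      then have "G M x = (\<Sum>z | z extreme_point_of (K \<inter> L). u z * G M z)"
        using u by (intro affine_fun_on_convex_combination) auto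
      also have "\<dots> = (\<Sum>z | z extreme_point_of (K \<inter> L). u z * v z)"
        using G[OF M(1)] extreme_point_of_face[OF M(2)] by (intro sum.cong) auto
      finally show ?thesis .
    qed
    then show ?thesis using KL face by metis
  qed
  \<comment> \<open>By \<open>agree\<close> the choice among the simplices containing
    \<open>x\<close> is immaterial. The value 0 elsewhere is the convention for functions on a
    set.\<close>
  define w where "w x = (if x \<in> \<Union>\<T> then G (SOME K. K \<in> \<T> \<and> x \<in> K) x else 0)" for x
  have w: "w x = G K x" if K: "K \<in> \<T>" "x \<in> K" for K x
  proof -
    let ?L = "SOME K. K \<in> \<T> \<and> x \<in> K"
    have "?L \<in> \<T> \<and> x \<in> ?L" by (rule someI) (use K in blast)
    then have "G ?L x = G K x" using agree K by blast
    moreover have "x \<in> \<Union>\<T>" using K by blast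
    ultimately show ?thesis by (simp only: w_def if_True)
  qed
  have "affine_fun_on K w" if K: "K \<in> \<T>" for K
    using aff[OF K] w[OF K] unfolding affine_fun_on_def by metis
  moreover have "continuous_on (\<Union>K\<in>\<T>. K) w"
  proof (rule continuous_on_closed_Union)
    show "finite \<T>" using \<T> by (simp add: triangulation_def)
    fix K assume K: "K \<in> \<T>"
    then show "closed K"
      using simplices simplex_imp_polytope polytope_imp_closed by blast
    obtain a c where ac: "\<And>x. G K x = a \<bullet> x + c" using aff[OF K] by blast
    have "continuous_on K (\<lambda>x. a \<bullet> x + c)" by (intro continuous_intros)
    then show "continuous_on K w"
      by (rule continuous_on_eq) (use w[OF K] ac in simp)
  qed
  moreover have "w z = v z" if z: "z \<in> nodes \<T>" for z
  proof -
    obtain K where K: "K \<in> \<T>" "z extreme_point_of K" using z by (auto simp: nodes_def)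
    then show ?thesis using w[of K z] G[of K z] by (simp add: extreme_point_of_def)
  qed
  ultimately show ?thesis
    by (intro exI[of _ w]) (auto simp: is_nodal_interpolant_def w_def)
qed

text \<open>Two interpolants of the same \<open>v\<close> are given at each covered point by the
  same weights and vanish elsewhere, so the description in \<open>nodal_interpolant\<close> is
  proper.\<close>

lemma is_nodal_interpolant_nodal_interpolant:
  assumes "triangulation \<T>"
  shows "is_nodal_interpolant \<T> v (nodal_interpolant \<T> v)"
proof -
  have "w x = w' x" if "is_nodal_interpolant \<T> v w" "is_nodal_interpolant \<T> v w'" for w w' x
  proof (cases "x \<in> \<Union>\<T>")
    case True
    then show ?thesis
      using interpolant_convex_combination[OF assms True] that by metis
  qed (use that in \<open>auto simp: is_nodal_interpolant_def\<close>)
  then have "\<exists>!w. is_nodal_interpolant \<T> v w"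
    using nodal_interpolant_exists[OF assms] by blast
  then show ?thesis
    unfolding nodal_interpolant_def is_nodal_interpolant_def by (rule theI')
qed

lemma nodal_interpolant_convex_combination:
  assumes "triangulation \<T>" "x \<in> \<Union>\<T>"
  obtains u where "\<And>z. z \<in> nodes \<T> \<Longrightarrow> 0 \<le> u z" "sum u (nodes \<T>) = 1"
    "\<And>v. nodal_interpolant \<T> v x = (\<Sum>z\<in>nodes \<T>. u z * v z)"
  using interpolant_convex_combination[OF assms]
    is_nodal_interpolant_nodal_interpolant[OF assms(1)] by metis

text \<open>Each node of \<open>\<T>\<close> is a point of the larger closed domain, so the value of
  the inner interpolant there is itself a convex combination of values at the nodes of
  \<open>\<T>'\<close>.\<close>

lemma interpolant_composition_convex_combination:
  assumes \<T>: "triangulation \<T>" "x \<in> \<Union>\<T>" and \<T>': "triangulation \<T>'" and sub: "\<Union>\<T> \<subseteq> \<Union>\<T>'"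
  obtains u where "\<And>y. y \<in> nodes \<T>' \<Longrightarrow> 0 \<le> u y" "sum u (nodes \<T>') = 1"
    "\<And>v. nodal_interpolant \<T> (restriction (\<Union>\<T>) (nodal_interpolant \<T>' v)) x =
      (\<Sum>y\<in>nodes \<T>'. u y * v y)"
proof -
  obtain a where a: "\<And>z. z \<in> nodes \<T> \<Longrightarrow> 0 \<le> a z" "sum a (nodes \<T>) = 1"
    "\<And>v. nodal_interpolant \<T> v x = (\<Sum>z\<in>nodes \<T>. a z * v z)"
    using nodal_interpolant_convex_combination[OF \<T>] by blast
  have "\<forall>z\<in>nodes \<T>. \<exists>c. (\<forall>y\<in>nodes \<T>'. 0 \<le> c y) \<and> sum c (nodes \<T>') = 1 \<and>
     (\<forall>v. nodal_interpolant \<T>' v z = (\<Sum>y\<in>nodes \<T>'. c y * v y))"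
  proof
    fix z assume "z \<in> nodes \<T>"
    then have "z \<in> \<Union>\<T>'" using nodes_subset sub by blast
    then show "\<exists>c. (\<forall>y\<in>nodes \<T>'. 0 \<le> c y) \<and> sum c (nodes \<T>') = 1 \<and>
     (\<forall>v. nodal_interpolant \<T>' v z = (\<Sum>y\<in>nodes \<T>'. c y * v y))"
      using nodal_interpolant_convex_combination[OF \<T>'] by metis
  qed
  then obtain c where c: "\<And>z y. z \<in> nodes \<T> \<Longrightarrow> y \<in> nodes \<T>' \<Longrightarrow> 0 \<le> c z y"
    "\<And>z. z \<in> nodes \<T> \<Longrightarrow> sum (c z) (nodes \<T>') = 1"
    "\<And>z v. z \<in> nodes \<T> \<Longrightarrow> nodal_interpolant \<T>' v z = (\<Sum>y\<in>nodes \<T>'. c z y * v y)"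
    by metis
  \<comment> \<open>A probability vector times a row-stochastic matrix, hence again a probability
    vector.\<close>
  define u where "u y = (\<Sum>z\<in>nodes \<T>. a z * c z y)" for y
  \<comment> \<open>Used with the constant 1 for the total weight and with \<open>v\<close> for the
    composed interpolant.\<close>
  have swap: "(\<Sum>y\<in>nodes \<T>'. u y * f y) = (\<Sum>z\<in>nodes \<T>. a z * (\<Sum>y\<in>nodes \<T>'. c z y * f y))" for f
    unfolding u_def sum_distrib_right sum_distrib_left
    by (subst sum.swap) (simp add: mult.assoc)
  show ?thesis
  proof
    show "0 \<le> u y" if "y \<in> nodes \<T>'" for y
      unfolding u_def using a c that by (intro sum_nonneg mult_nonneg_nonneg) auto
    show "sum u (nodes \<T>') = 1" using swap[of "\<lambda>_. 1"] a c by simp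
    fix v
    have "nodal_interpolant \<T> (restriction (\<Union>\<T>) (nodal_interpolant \<T>' v)) x =
        (\<Sum>z\<in>nodes \<T>. a z * nodal_interpolant \<T>' v z)"
      unfolding a(3) using nodes_subset[of \<T>] by (intro sum.cong) (auto simp: restriction_def)
    also have "\<dots> = (\<Sum>y\<in>nodes \<T>'. u y * v y)" unfolding swap by (intro sum.cong) (simp_all add: c)
    finally show "nodal_interpolant \<T> (restriction (\<Union>\<T>) (nodal_interpolant \<T>' v)) x =
        (\<Sum>y\<in>nodes \<T>'. u y * v y)" .
  qed
qed

section \<open>Hilbert spaces of functions\<close>

context function_hilbert_space
begin

section \<open>Linear combinations and the inner product\<close>

lemma sum_mem:
  assumes "\<And>i. i \<in> I \<Longrightarrow> g i \<in> H"
  shows "(\<lambda>x. \<Sum>i\<in>I. c i * g i x) \<in> H"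
  using assms
proof (induction I rule: infinite_finite_induct)
  case (insert i I)
  then show ?case
    using add_mem[OF scale_mem[of "g i" "c i"], of "\<lambda>x. \<Sum>i\<in>I. c i * g i x"] by simp
qed (auto simp: zero_mem)

lemma ip_zero_left: "h \<in> H \<Longrightarrow> ip (\<lambda>x. 0) h = 0"
  using ip_scale[of "\<lambda>x. 0" h 0] zero_mem by simp

lemma ip_sum_left:
  assumes "\<And>i. i \<in> I \<Longrightarrow> g i \<in> H" "h \<in> H"
  shows "ip (\<lambda>x. \<Sum>i\<in>I. c i * g i x) h = (\<Sum>i\<in>I. c i * ip (g i) h)"
  using assms(1)
proof (induction I rule: infinite_finite_induct)
  case (insert i I)
  then show ?case
    using ip_add[OF scale_mem[of "g i" "c i"] sum_mem[of I g c] assms(2)] ip_scale assms(2) by simp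
qed (auto simp: ip_zero_left assms)

lemma ip_sum_right:
  assumes "\<And>i. i \<in> I \<Longrightarrow> g i \<in> H" "h \<in> H"
  shows "ip h (\<lambda>x. \<Sum>i\<in>I. c i * g i x) = (\<Sum>i\<in>I. c i * ip h (g i))"
proof -
  have "ip h (\<lambda>x. \<Sum>i\<in>I. c i * g i x) = (\<Sum>i\<in>I. c i * ip (g i) h)"
    using ip_commute[OF assms(2) sum_mem[of I g c]] ip_sum_left[OF assms] assms(1) by simp
  also have "\<dots> = (\<Sum>i\<in>I. c i * ip h (g i))"
    by (intro sum.cong refl) (simp add: ip_commute assms)
  finally show ?thesis .
qed

section \<open>Bessel's inequality, the Cauchy-Schwarz inequality and orthonormal bases\<close>

lemma ip_diff_self:
  assumes "f \<in> H" "g \<in> H"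
  shows "ip (\<lambda>x. f x - g x) (\<lambda>x. f x - g x) = ip f f - 2 * ip f g + ip g g"
proof -
  \<comment> \<open>The difference is written as a sum with a scalar multiple, the form to which the
    axioms on \<open>H\<close> and \<open>ip\<close> apply.\<close>
  define r where "r = (\<lambda>x. f x + (-1) * g x)"
  have m: "(\<lambda>x. (-1) * g x) \<in> H" by (rule scale_mem[OF assms(2)])
  have r: "r \<in> H" unfolding r_def by (rule add_mem[OF assms(1) m])
  have *: "ip r h = ip f h - ip g h" if "h \<in> H" for h
    unfolding r_def ip_add[OF assms(1) m that] ip_scale[OF assms(2) that] by simp
  have "ip r r = ip r f - ip r g"
    using *[OF r] ip_commute[OF r] assms by simp
  then have "ip r r = ip f f - 2 * ip f g + ip g g"
    using *[of f] *[of g] assms ip_commute[of f g] by simp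
  then show ?thesis by (simp add: r_def)
qed

text \<open>The orthogonal projection \<open>p\<close> of \<open>k\<close> onto the span of
  \<open>F\<close> has the left-hand side as its squared norm, and the squared norm of
  \<open>k - p\<close> is nonnegative.\<close>

lemma bessel:
  assumes "finite F" "F \<subseteq> H" "k \<in> H"
    and on: "\<And>e e'. e \<in> F \<Longrightarrow> e' \<in> F \<Longrightarrow> ip e e' = (if e = e' then 1 else 0)"
  shows "(\<Sum>e\<in>F. (ip e k)\<^sup>2) \<le> ip k k"
proof -
  define p where "p = (\<lambda>x. \<Sum>e\<in>F. ip e k * e x)"
  have mem: "\<And>e. e \<in> F \<Longrightarrow> e \<in> H" using assms(2) by blast
  have p: "p \<in> H" unfolding p_def by (rule sum_mem[of F "\<lambda>e. e"]) (rule mem)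
  have ep: "ip e p = ip e k" if "e \<in> F" for e
  proof -
    have "ip e p = (\<Sum>e'\<in>F. ip e' k * ip e e')"
      unfolding p_def by (rule ip_sum_right[of F "\<lambda>e. e"]) (auto simp: mem that)
    also have "\<dots> = (\<Sum>e'\<in>F. if e = e' then ip e' k else 0)"
      by (intro sum.cong) (auto simp: on that)
    finally show ?thesis using assms(1) that by simp
  qed
  have "ip p h = (\<Sum>e\<in>F. ip e k * ip e h)" if "h \<in> H" for h
    unfolding p_def by (rule ip_sum_left[of F "\<lambda>e. e"]) (auto simp: mem that)
  from this[OF assms(3)] this[OF p] have "ip p k = (\<Sum>e\<in>F. (ip e k)\<^sup>2)" "ip p p = (\<Sum>e\<in>F. (ip e k)\<^sup>2)"
    by (auto simp: power2_eq_square ep)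
  moreover have "ip k p = ip p k" using ip_commute p assms(3) by blast
  \<comment> \<open>Expanding this square leaves \<open>ip k k\<close> minus the sum, since
    \<open>ip k p\<close> and \<open>ip p p\<close> both equal the sum.\<close>
  moreover have "0 \<le> ip (\<lambda>x. k x - p x) (\<lambda>x. k x - p x)"
    using ip_nonneg add_mem[OF assms(3) scale_mem[OF p, of "-1"]] by simp
  ultimately show ?thesis using ip_diff_self[OF assms(3) p] by simp
qed

lemma normalize:
  assumes "f \<in> H" "ip f f \<noteq> 0"
  defines "e \<equiv> \<lambda>x. (1 / sqrt (ip f f)) * f x"
  shows "e \<in> H" "ip e e = 1" "h \<in> H \<Longrightarrow> ip e h = ip f h / sqrt (ip f f)"
proof -
  have pos: "ip f f > 0" using assms ip_nonneg[of f] by simp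
  show e: "e \<in> H" unfolding e_def by (rule scale_mem[OF assms(1)])
  have *: "ip e h = ip f h / sqrt (ip f f)" if "h \<in> H" for h
    unfolding e_def by (subst ip_scale) (simp_all add: assms(1) that)
  then show "h \<in> H \<Longrightarrow> ip e h = ip f h / sqrt (ip f f)" .
  have "ip e e = ip e f / sqrt (ip f f)" using *[OF e] ip_commute[OF assms(1) e] by simp
  also have "\<dots> = 1" using *[OF assms(1)] pos by simp
  finally show "ip e e = 1" .
qed

text \<open>Bessel's inequality for the single unit vector obtained from \<open>f\<close>; if
  \<open>f\<close> has norm zero, definiteness makes both sides vanish.\<close>

lemma cauchy_schwarz:
  assumes "f \<in> H" "k \<in> H"
  shows "(ip f k)\<^sup>2 \<le> ip f f * ip k k"
proof (cases "ip f f = 0")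
  case True
  then show ?thesis using ip_definite[OF assms(1) True] ip_zero_left[OF assms(2)] by simp
next
  case False
  obtain e where e: "e \<in> H" "ip e e = 1" "ip e k = ip f k / sqrt (ip f f)"
    using normalize[OF assms(1) False] assms(2) by blast
  have pos: "ip f f > 0" using False ip_nonneg[OF assms(1)] by simp
  have "(ip e k)\<^sup>2 \<le> ip k k" using bessel[of "{e}" k] e(1,2) assms(2) by simp
  then show ?thesis using pos by (simp add: e(3) power_divide divide_le_eq mult.commute)
qed

text \<open>Zorn's lemma gives a maximal orthonormal set. A nonzero vector orthogonal to it could be
  normalized and added, so it is total.\<close>

lemma orthonormal_basis_exists: "\<exists>E. orthonormal_basis H ip E"
proof -
  define \<A> where "\<A> = {E. E \<subseteq> H \<and> (\<forall>e\<in>E. \<forall>e'\<in>E. ip e e' = (if e = e' then 1 else 0))}"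
  have "\<Union>C \<in> \<A>" if C: "subset.chain \<A> C" for C
  proof -
    have CA: "\<And>A. A \<in> C \<Longrightarrow> A \<in> \<A>" using C by (auto simp: subset.chain_def)
    \<comment> \<open>Orthonormality constrains only pairs, and any two elements of the union lie in
      one member of the chain.\<close>
    have "\<exists>B\<in>C. e \<in> B \<and> e' \<in> B" if ee: "e \<in> \<Union>C" "e' \<in> \<Union>C" for e e'
    proof -
      obtain A A' where A: "A \<in> C" "e \<in> A" "A' \<in> C" "e' \<in> A'" using ee by blast
      then have "A \<subseteq> A' \<or> A' \<subseteq> A" using C by (auto simp: subset_chain_def)
      with A show ?thesis by blast
    qed
    with CA show ?thesis unfolding \<A>_def by blast
  qed
  from subset_Zorn'[OF this] obtain E where E: "E \<in> \<A>" and max: "\<And>X. X \<in> \<A> \<Longrightarrow> E \<subseteq> X \<Longrightarrow> X = E"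
    by blast
  have total: "f = (\<lambda>x. 0)" if f: "f \<in> H" "\<forall>e\<in>E. ip f e = 0" for f
  proof (rule ccontr)
    assume "f \<noteq> (\<lambda>x. 0)"
    then have nz: "ip f f \<noteq> 0" using ip_definite f by blast
    let ?e = "\<lambda>x. (1 / sqrt (ip f f)) * f x"
    note e = normalize[OF f(1) nz]
    have ortho: "ip ?e e' = 0" "ip e' ?e = 0" if "e' \<in> E" for e'
    proof -
      have "e' \<in> H" using E that by (auto simp: \<A>_def)
      then show "ip ?e e' = 0" using e(3)[of e'] f(2) that by simp
      then show "ip e' ?e = 0" using ip_commute[OF e(1) \<open>e' \<in> H\<close>] by simp
    qed
    have "?e \<notin> E" using ortho e(2) by fastforce
    have "insert ?e E \<in> \<A>" using E e(1,2) ortho \<open>?e \<notin> E\<close> unfolding \<A>_def by auto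
    with max[of "insert ?e E"] \<open>?e \<notin> E\<close> show False by blast
  qed
  have "orthonormal_basis H ip E"
    unfolding orthonormal_basis_def
  proof (intro conjI ballI impI)
    show "f = (\<lambda>x. 0)" if "f \<in> H" "\<forall>e\<in>E. ip f e = 0" for f by (rule total[OF that])
  qed (use E in \<open>auto simp: \<A>_def\<close>)
  then show ?thesis by blast
qed

text \<open>A bounded measurable field \<open>k\<close> of representers makes the operator Hilbert-Schmidt, as
  Bessel's inequality applies at each point \<open>x\<close> separately.\<close>

lemma hilbert_schmidt_representers:
  fixes M :: "'b measure" and k :: "'b \<Rightarrow> 'a \<Rightarrow> real"
  assumes b: "b \<in> L2_space M" and "0 \<le> c"
    and k: "\<And>x. x \<in> space M \<Longrightarrow> k x \<in> H" "\<And>x. x \<in> space M \<Longrightarrow> ip (k x) (k x) \<le> c\<^sup>2"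
    and T: "\<And>f x. f \<in> H \<Longrightarrow> x \<in> space M \<Longrightarrow> T f x = b x * ip f (k x)"
    and meas: "\<And>f. f \<in> H \<Longrightarrow> T f \<in> borel_measurable M"
  shows "hilbert_schmidt H ip M T" and "hs_norm H ip M T \<le> c * L2_norm M b"
proof -
  have ib: "integrable M (\<lambda>x. (b x)\<^sup>2)" using b by (simp add: L2_space_def)
  have nn: "0 \<le> (LINT x|M. (b x)\<^sup>2)" by simp
  \<comment> \<open>The Cauchy-Schwarz inequality at each point gives an integrable majorant, which
    serves both square integrability and the operator bound.\<close>
  have pt: "(T f x)\<^sup>2 \<le> c\<^sup>2 * ip f f * (b x)\<^sup>2" if "f \<in> H" "x \<in> space M" for f x
  proof -
    have "(ip f (k x))\<^sup>2 \<le> ip f f * ip (k x) (k x)" by (rule cauchy_schwarz) (use that k in auto)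
    also have "\<dots> \<le> ip f f * c\<^sup>2" using k that ip_nonneg by (intro mult_left_mono) auto
    finally have "(b x)\<^sup>2 * (ip f (k x))\<^sup>2 \<le> (b x)\<^sup>2 * (ip f f * c\<^sup>2)" by (intro mult_left_mono) auto
    then show ?thesis by (simp add: T that power_mult_distrib mult_ac)
  qed
  have int: "integrable M (\<lambda>x. (T f x)\<^sup>2)" if "f \<in> H" for f
  proof (rule Bochner_Integration.integrable_bound)
    show "integrable M (\<lambda>x. c\<^sup>2 * ip f f * (b x)\<^sup>2)" using ib by simp
    show "(\<lambda>x. (T f x)\<^sup>2) \<in> borel_measurable M" using meas[OF that] by measurable
    show "AE x in M. norm ((T f x)\<^sup>2) \<le> norm (c\<^sup>2 * ip f f * (b x)\<^sup>2)"
      using pt[OF that] ip_nonneg[OF that] by (intro AE_I2) simp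
  qed
  have bdd: "L2_norm M (T f) \<le> (c * L2_norm M b) * sqrt (ip f f)" if "f \<in> H" for f
  proof -
    have "(LINT x|M. (T f x)\<^sup>2) \<le> (LINT x|M. c\<^sup>2 * ip f f * (b x)\<^sup>2)"
      using int[OF that] ib pt[OF that] by (intro integral_mono) auto
    also have "\<dots> = c\<^sup>2 * ip f f * (LINT x|M. (b x)\<^sup>2)" by simp
    finally have "L2_norm M (T f) \<le> sqrt (c\<^sup>2 * ip f f * (LINT x|M. (b x)\<^sup>2))"
      by (simp add: L2_norm_def)
    then show ?thesis using \<open>0 \<le> c\<close> by (simp add: L2_norm_def real_sqrt_mult mult_ac)
  qed
  have bl: "bounded_linear_to_L2 H ip M T"
    unfolding bounded_linear_to_L2_def
  proof (intro conjI ballI allI)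
    show "T f \<in> L2_space M" if "f \<in> H" for f using meas int that by (simp add: L2_space_def)
    show "AE x in M. T (\<lambda>y. f y + g y) x = T f x + T g x" if "f \<in> H" "g \<in> H" for f g
      using that k by (intro AE_I2) (simp add: T add_mem ip_add algebra_simps)
    show "AE x in M. T (\<lambda>y. a * f y) x = a * T f x" if "f \<in> H" for f a
      using that k by (intro AE_I2) (simp add: T scale_mem ip_scale)
    show "\<exists>C. \<forall>f\<in>H. L2_norm M (T f) \<le> C * sqrt (ip f f)" using bdd by blast
  qed
  \<comment> \<open>The bound is uniform in the finite set \<open>F\<close>, so it yields
    summability as well as the estimate of the infinite sum.\<close>
  have fin: "(\<Sum>e\<in>F. (L2_norm M (T e))\<^sup>2) \<le> c\<^sup>2 * (LINT x|M. (b x)\<^sup>2)"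
    if E: "orthonormal_basis H ip E" and F: "finite F" "F \<subseteq> E" for E F
  proof -
    have FH: "\<And>e. e \<in> F \<Longrightarrow> e \<in> H" using E F by (auto simp: orthonormal_basis_def)
    have "(\<Sum>e\<in>F. (L2_norm M (T e))\<^sup>2) = (\<Sum>e\<in>F. LINT x|M. (T e x)\<^sup>2)"
      by (simp add: L2_norm_def)
    also have "\<dots> = (LINT x|M. (\<Sum>e\<in>F. (T e x)\<^sup>2))"
      using int FH by (subst Bochner_Integration.integral_sum) auto
    also have "\<dots> \<le> (LINT x|M. c\<^sup>2 * (b x)\<^sup>2)"
    proof (rule integral_mono)
      show "integrable M (\<lambda>x. \<Sum>e\<in>F. (T e x)\<^sup>2)" using int FH by auto
      show "integrable M (\<lambda>x. c\<^sup>2 * (b x)\<^sup>2)" using ib by simp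
      fix x assume x: "x \<in> space M"
      have "(\<Sum>e\<in>F. (ip e (k x))\<^sup>2) \<le> ip (k x) (k x)"
        using E F k x by (intro bessel) (auto simp: orthonormal_basis_def subset_iff)
      also have "\<dots> \<le> c\<^sup>2" using k x by blast
      finally have "(b x)\<^sup>2 * (\<Sum>e\<in>F. (ip e (k x))\<^sup>2) \<le> (b x)\<^sup>2 * c\<^sup>2" by (intro mult_left_mono) auto
      then show "(\<Sum>e\<in>F. (T e x)\<^sup>2) \<le> c\<^sup>2 * (b x)\<^sup>2"
        using FH x by (simp add: T power_mult_distrib sum_distrib_left mult.commute)
    qed
    also have "\<dots> = c\<^sup>2 * (LINT x|M. (b x)\<^sup>2)" by simp
    finally show ?thesis .
  qed
  have summ: "(\<lambda>e. (L2_norm M (T e))\<^sup>2) summable_on E" if "orthonormal_basis H ip E" for E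
    using fin[OF that] by (intro nonneg_bdd_above_summable_on bdd_aboveI2) auto
  show "hilbert_schmidt H ip M T" using bl summ by (simp add: hilbert_schmidt_def)
  let ?E = "SOME E. orthonormal_basis H ip E"
  \<comment> \<open>\<open>hs_norm\<close> picks its basis by \<open>SOME\<close>; the estimate
    reaches that choice only because a basis exists.\<close>
  have E: "orthonormal_basis H ip ?E" by (rule someI_ex[OF orthonormal_basis_exists])
  have "(\<Sum>\<^sub>\<infinity>e\<in>(?E). (L2_norm M (T e))\<^sup>2) \<le> c\<^sup>2 * (LINT x|M. (b x)\<^sup>2)"
    by (rule infsum_le_finite_sums[OF summ[OF E]]) (use fin[OF E] in blast)
  then have "hs_norm H ip M T \<le> sqrt (c\<^sup>2 * (LINT x|M. (b x)\<^sup>2))" by (simp add: hs_norm_def)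
  then show "hs_norm H ip M T \<le> c * L2_norm M b"
    using \<open>0 \<le> c\<close> by (simp add: real_sqrt_mult L2_norm_def)
qed

end

section \<open>Kernel sections and bounds of the kernel\<close>

text \<open>By the reproducing property \<open>k\<close> represents the functional that averages the
  values on \<open>Y\<close>. Applied to \<open>k\<close> itself, this makes \<open>ip k k\<close> a
  double convex combination of the values \<open>q y z\<close>.\<close>

lemma (in rkhs) convex_combination_representer:
  assumes "finite Y" "Y \<subseteq> X" "\<And>y. y \<in> Y \<Longrightarrow> 0 \<le> u y" "sum u Y = 1"
    and q: "\<And>y z. y \<in> Y \<Longrightarrow> z \<in> Y \<Longrightarrow> q y z \<le> C"
  defines "k \<equiv> \<lambda>x. \<Sum>y\<in>Y. u y * restriction X (\<lambda>z. q z y) x"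
  shows "k \<in> H" "f \<in> H \<Longrightarrow> ip f k = (\<Sum>y\<in>Y. u y * f y)" "ip k k \<le> C"
proof -
  have mem: "restriction X (\<lambda>z. q z y) \<in> H" if "y \<in> Y" for y using that assms(2) kernel_mem by blast
  show k: "k \<in> H" unfolding k_def by (rule sum_mem) (rule mem)
  have ev: "ip f k = (\<Sum>y\<in>Y. u y * f y)" if "f \<in> H" for f
  proof -
    have "ip f k = (\<Sum>y\<in>Y. u y * ip f (restriction X (\<lambda>z. q z y)))"
      unfolding k_def by (rule ip_sum_right) (auto simp: mem that)
    also have "\<dots> = (\<Sum>y\<in>Y. u y * f y)"
      using that assms(2) by (intro sum.cong refl) (auto simp: reproducing[of f, symmetric])
    finally show ?thesis .
  qed
  then show "f \<in> H \<Longrightarrow> ip f k = (\<Sum>y\<in>Y. u y * f y)" .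
  have ky: "k z \<le> C" if "z \<in> Y" for z
  proof -
    have "k z = (\<Sum>y\<in>Y. u y * q z y)" using that assms(2) by (auto simp: k_def restriction_def)
    also have "\<dots> \<le> (\<Sum>y\<in>Y. u y * C)" using assms that by (intro sum_mono mult_left_mono) auto
    finally show ?thesis using assms(4) by (simp flip: sum_distrib_right)
  qed
  have "ip k k \<le> (\<Sum>y\<in>Y. u y * C)"
    unfolding ev[OF k] using assms(3) ky by (intro sum_mono mult_left_mono) auto
  then show "ip k k \<le> C" using assms(4) by (simp flip: sum_distrib_right)
qed

text \<open>The supremum runs over the open domain, while nodes may lie on its boundary. Continuity
  carries the bound over, because the interval from \<open>- (c\<^sup>2)\<close> to
  \<open>c\<^sup>2\<close> is closed.\<close>

lemma kernel_bound_closure: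
  fixes S :: "'a::topological_space set" and q :: "'a \<Rightarrow> 'a \<Rightarrow> real"
  assumes cont: "continuous_on (closure S \<times> closure S) (\<lambda>(x, y). q x y)"
    and bdd: "bounded ((\<lambda>(x, y). q x y) ` (closure S \<times> closure S))" and "S \<noteq> {}"
  defines "c \<equiv> (SUP (x, y) \<in> S \<times> S. sqrt \<bar>q x y\<bar>)"
  shows "0 \<le> c" and "y \<in> closure S \<Longrightarrow> z \<in> closure S \<Longrightarrow> \<bar>q y z\<bar> \<le> c\<^sup>2"
proof -
  obtain B where B: "\<And>x y. x \<in> closure S \<Longrightarrow> y \<in> closure S \<Longrightarrow> \<bar>q x y\<bar> \<le> B"
    using bdd by (fastforce simp: bounded_iff)
  \<comment> \<open>A real supremum is an upper bound only for a set that is bounded above.\<close>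
  have bdd': "bdd_above ((\<lambda>(x, y). sqrt \<bar>q x y\<bar>) ` (S \<times> S))"
    using B closure_subset[of S] by (intro bdd_aboveI[of _ "sqrt B"]) (auto simp: subset_iff)
  have up: "sqrt \<bar>q x y\<bar> \<le> c" if "x \<in> S" "y \<in> S" for x y
    unfolding c_def using cSUP_upper[OF _ bdd', of "(x, y)"] that by simp
  obtain s where "s \<in> S" using \<open>S \<noteq> {}\<close> by blast
  with up[of s s] show c: "0 \<le> c" using real_sqrt_ge_zero[of "\<bar>q s s\<bar>"] by linarith
  have up2: "\<bar>q x y\<bar> \<le> c\<^sup>2" if "x \<in> S" "y \<in> S" for x y
    using up[OF that] c by (simp add: sqrt_le_D)
  show "\<bar>q y z\<bar> \<le> c\<^sup>2" if "y \<in> closure S" "z \<in> closure S"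
  proof -
    have "continuous_on (closure (S \<times> S)) (\<lambda>(x, y). q x y)" using cont by (simp add: closure_Times)
    moreover have "(\<lambda>(x, y). q x y) ` (S \<times> S) \<subseteq> {- (c\<^sup>2)..c\<^sup>2}"
      using up2 by (force simp: abs_le_iff)
    ultimately have "(\<lambda>(x, y). q x y) ` closure (S \<times> S) \<subseteq> {- (c\<^sup>2)..c\<^sup>2}"
      by (intro image_closure_subset) auto
    then have "q y z \<in> {- (c\<^sup>2)..c\<^sup>2}" using that by (force simp: closure_Times)
    then show ?thesis by auto
  qed
qed

section \<open>The Hilbert-Schmidt estimate for the composed interpolation operator\<close>

theorem lemma4p2:
  fixes D S :: "(real ^ 'd) set"
    and Th Th' :: "(real ^ 'd) set set"
    and q :: "real ^ 'd \<Rightarrow> real ^ 'd \<Rightarrow> real"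
    and H :: "(real ^ 'd \<Rightarrow> real) set"
    and ip :: "(real ^ 'd \<Rightarrow> real) \<Rightarrow> (real ^ 'd \<Rightarrow> real) \<Rightarrow> real"
  assumes "CARD('d) \<le> 3"
    and "polyhedral_domain D" and "polyhedral_domain S" and "D \<subseteq> S"
    and "triangulation_of Th D" and "triangulation_of Th' S"
    and "psd_kernel_on (closure S) q"
    and "continuous_on (closure S \<times> closure S) (\<lambda>(x, y). q x y)"
    and "bounded ((\<lambda>(x, y). q x y) ` (closure S \<times> closure S))"
    and "rkhs (closure S) q H ip"
  shows "\<forall>b \<in> L2_space (lebesgue_on D).
    hilbert_schmidt H ip (lebesgue_on D)
      (mult_op b \<circ> nodal_interpolant Th \<circ> restriction (closure D) \<circ> nodal_interpolant Th') \<and>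
    hs_norm H ip (lebesgue_on D)
      (mult_op b \<circ> nodal_interpolant Th \<circ> restriction (closure D) \<circ> nodal_interpolant Th')
    \<le> 2 * (SUP (x, y) \<in> S \<times> S. sqrt \<bar>q x y\<bar>) * L2_norm (lebesgue_on D) b"
proof
  fix b assume b: "b \<in> L2_space (lebesgue_on D)"
  interpret rkhs "closure S" q H ip by fact
  let ?T = "mult_op b \<circ> nodal_interpolant Th \<circ> restriction (closure D) \<circ> nodal_interpolant Th'"
  define c where "c = (SUP (x, y) \<in> S \<times> S. sqrt \<bar>q x y\<bar>)"
  have Th: "triangulation Th" "\<Union>Th = closure D" and Th': "triangulation Th'" "\<Union>Th' = closure S"
    using assms(5,6) by (auto simp: triangulation_of_def)
  have "open D" "S \<noteq> {}" using assms(2,3) by (auto simp: polyhedral_domain_def)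
  note qc = kernel_bound_closure[OF assms(8,9) \<open>S \<noteq> {}\<close>, folded c_def]
  have sub: "\<Union>Th \<subseteq> \<Union>Th'" unfolding Th Th' by (rule closure_mono[OF assms(4)])
  \<comment> \<open>The representer is found separately at each point; a choice over
    \<open>x\<close> then gives the field \<open>k\<close>.\<close>
  have "\<forall>x\<in>D. \<exists>k. k \<in> H \<and> ip k k \<le> c\<^sup>2 \<and> (\<forall>f\<in>H. ?T f x = b x * ip f k)"
  proof
    fix x assume "x \<in> D"
    then have x: "x \<in> \<Union>Th" using Th(2) closure_subset by auto
    obtain u where u: "\<And>y. y \<in> nodes Th' \<Longrightarrow> 0 \<le> u y" "sum u (nodes Th') = 1"
      "\<And>v. nodal_interpolant Th (restriction (closure D) (nodal_interpolant Th' v)) x =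
        (\<Sum>y\<in>nodes Th'. u y * v y)"
      using interpolant_composition_convex_combination[OF Th(1) x Th'(1) sub] unfolding Th(2) by blast
    have nodes: "nodes Th' \<subseteq> closure S" using nodes_subset[of Th'] Th' by simp
    have bound: "q y z \<le> c\<^sup>2" if "y \<in> nodes Th'" "z \<in> nodes Th'" for y z
      using qc(2)[of y z] nodes that by (auto simp: abs_le_iff)
    note rep = convex_combination_representer[OF finite_nodes[OF Th'(1)] nodes u(1,2) bound]
    show "\<exists>k. k \<in> H \<and> ip k k \<le> c\<^sup>2 \<and> (\<forall>f\<in>H. ?T f x = b x * ip f k)"
    proof (intro exI conjI ballI)
      show "?T f x = b x * ip f (\<lambda>x. \<Sum>y\<in>nodes Th'. u y * restriction (closure S) (\<lambda>z. q z y) x)"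
        if "f \<in> H" for f
        using rep(2)[of f] that by (simp add: mult_op_def u(3))
    qed (use rep(1,3) in blast)+
  qed
  then obtain k where k: "\<And>x. x \<in> D \<Longrightarrow> k x \<in> H" "\<And>x. x \<in> D \<Longrightarrow> ip (k x) (k x) \<le> c\<^sup>2"
    "\<And>f x. f \<in> H \<Longrightarrow> x \<in> D \<Longrightarrow> ?T f x = b x * ip f (k x)"
    by metis
  have meas: "?T f \<in> borel_measurable (lebesgue_on D)" for f
  proof -
    \<comment> \<open>Measurability comes from the outer interpolant, which is continuous for
      arbitrary nodal data.\<close>
    have "continuous_on D (nodal_interpolant Th v)" for v
      using is_nodal_interpolant_nodal_interpolant[OF Th(1), of v] closure_subset[of D]
      by (auto simp: is_nodal_interpolant_def Th(2) intro: continuous_on_subset)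
    then have "nodal_interpolant Th v \<in> borel_measurable (lebesgue_on D)" for v
      using \<open>open D\<close> by (intro continuous_imp_measurable_on_sets_lebesgue) auto
    moreover have "b \<in> borel_measurable (lebesgue_on D)" using b by (simp add: L2_space_def)
    ultimately show ?thesis by (simp add: mult_op_def borel_measurable_times)
  qed
  have "hilbert_schmidt H ip (lebesgue_on D) ?T"
    and le: "hs_norm H ip (lebesgue_on D) ?T \<le> c * L2_norm (lebesgue_on D) b"
    using hilbert_schmidt_representers[OF b qc(1), of k ?T] k meas by simp_all
  \<comment> \<open>The bound just obtained has constant 1, so nonnegativity suffices to pass to the
    constant 2.\<close>
  moreover have "0 \<le> c * L2_norm (lebesgue_on D) b" using qc(1) by (simp add: L2_norm_def)
  ultimately show "hilbert_schmidt H ip (lebesgue_on D) ?T \<and> hs_norm H ip (lebesgue_on D) ?T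
      \<le> 2 * (SUP (x, y) \<in> S \<times> S. sqrt \<bar>q x y\<bar>) * L2_norm (lebesgue_on D) b"
    unfolding c_def[symmetric] by simp
qed

end
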